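(* Let $\nabla$ be an $h$-connection of $E$, let $\varepsilon\in\{+,-\}$, and let $C_{\varepsilon,1},C_{\varepsilon,2}$, $\theta_{\varepsilon,1},\theta_{\varepsilon,2}\in(0,2\pi)$ and $\phi_\varepsilon\in(0,\pi/2]$ be the generators of $G_{\hat\nabla,\varepsilon}$ and the associated angles. Suppose that $\theta_{\varepsilon,k}=q_k\pi$ for $k=1,2$ with $(q_1,q_2)\in(\mathbb{Q}\times\mathbb{Q})\setminus(\mathbb{Z}\times\mathbb{Z})$, and that $\phi_\varepsilon$ satisfies $f_{\theta_{\varepsilon,1},\theta_{\varepsilon,2}}(\phi_\varepsilon)\in I_{\theta_{\varepsilon,1},\theta_{\varepsilon,2}}\setminus S$. Then the topological holonomy group $G_{\hat\nabla,\varepsilon}$ is generated by the finite order elements $C_{\varepsilon,1}$, $C_{\varepsilon,2}$, and $(C_{\varepsilon,1}C_{\varepsilon,2},\,C_{\varepsilon,2}C_{\varepsilon,1})$ is a noncommutative pair (i.e. a pair of elements that do not commute with each other) of two infinite order elements of $G_{\hat\nabla,\varepsilon}$.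
   Context: Let $T^2=S^1\times S^1$ with $S^1=\mathbb{R}/2\pi\mathbb{Z}$ and let $\mathrm{pr}:\mathbb{R}^2\to T^2$ be the projection. $E$ is an oriented real vector bundle of rank 4 over $T^2$ with a positive-definite metric $h$. An $h$-connection is a connection $\nabla$ of $E$ with $\nabla h=0$. $\bigwedge^2E$ with the induced metric $\hat h$ decomposes into rank 3 subbundles $\bigwedge^2_+E\oplus\bigwedge^2_-E$: for a local positively oriented orthonormal frame $(e_1,e_2,e_3,e_4)$ of $E$, $\bigwedge^2_\pm E$ has the local orthonormal frame $\Omega_{\pm,1}=\frac1{\sqrt2}(e_1\wedge e_2\pm e_3\wedge e_4)$, $\Omega_{\pm,2}=\frac1{\sqrt2}(e_1\wedge e_3\pm e_4\wedge e_2)$, $\Omega_{\pm,3}=\frac1{\sqrt2}(e_1\wedge e_4\pm e_2\wedge e_3)$, and is oriented by it. $\nabla$ induces an $\hat h$-connection $\hat\nabla$ of $\bigwedge^2E$, which restricts to $\bigwedge^2_\pm E$. For $\varepsilon\in\{+,-\}$ fix a positively oriented orthonormal basis $(\omega_{\varepsilon,1},\omega_{\varepsilon,2},\omega_{\varepsilon,3})$ of the fiber of $\bigwedge^2_\varepsilon E$ at $\mathrm{pr}(0,0)$. Let $\tilde\Omega_{\varepsilon,i,x}$ (resp. $\tilde\Omega_{\varepsilon,i,y}$) be the $\hat\nabla$-parallel sections of $\mathrm{pr}^*\bigwedge^2_\varepsilon E$ along the $x$-axis (resp. $y$-axis) with value $\omega_{\varepsilon,i}$ at $(0,0)$. Identifying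 the fibers of the pull-back at $(x+2\pi m,y+2\pi n)$ and $(x,y)$ for $m,n\in\mathbb{Z}$, there are $C_{\varepsilon,1},C_{\varepsilon,2}\in SO(3)$ such that for all $a,b\in\mathbb{R}$: $(\tilde\Omega_{\varepsilon,i,x}(a+2\pi,0))_{i=1,2,3}=(\tilde\Omega_{\varepsilon,i,x}(a,0))_{i=1,2,3}\,C_{\varepsilon,1}$ and $(\tilde\Omega_{\varepsilon,i,y}(0,b+2\pi))_{i=1,2,3}=(\tilde\Omega_{\varepsilon,i,y}(0,b))_{i=1,2,3}\,C_{\varepsilon,2}$ (row vectors times matrices). The topological holonomy group $G_{\hat\nabla,\varepsilon}$ of $\hat\nabla$ in $\bigwedge^2_\varepsilon E$ at $\mathrm{pr}(0,0)$ is the subgroup of $SO(3)$ generated by $C_{\varepsilon,1},C_{\varepsilon,2}$. Angles: put $C(\theta)=\begin{pmatrix}1&0&0\\0&\cos\theta&-\sin\theta\\0&\sin\theta&\cos\theta\end{pmatrix}$. The basis is chosen so that $C_{\varepsilon,1}=C(\theta_{\varepsilon,1})$ with $\theta_{\varepsilon,1}\in[0,2\pi)$; write $C_{\varepsilon,2}=V_{\varepsilon,2}C(\theta_{\varepsilon,2})\,{}^tV_{\varepsilon,2}$ with $\theta_{\varepsilon,2}\in[0,2\pi)$, $V_{\varepsilon,2}\in SO(3)$. It is assumed that $C_{\varepsilon,1},C_{\varepsilon,2}\neq E_3$ (the identity matrix). The choice is made so that $\phi_\varepsilon\in[0,\pi/2]$, the angle between ${}^t[1\ 0\ 0]$ and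 the first column of $V_{\varepsilon,2}$ (the angle between the rotation axes), and $\phi_\varepsilon\in(0,\pi/2]$ is assumed. For $\theta_1,\theta_2\in(0,2\pi)$ and $\phi\in(0,\pi/2]$ put $$f_{\theta_1,\theta_2}(\phi)=\cos\theta_1\cos\theta_2-2\sin\theta_1\sin\theta_2\cos\phi+(1+\cos\theta_1\cos\theta_2)\cos^2\phi+(\cos\theta_1+\cos\theta_2)\sin^2\phi,$$ $I_{\theta_1,\theta_2}=\{f_{\theta_1,\theta_2}(\phi)\mid\phi\in(0,\pi/2]\}$, and $S=\{1+2\cos(q\pi)\mid q\in\mathbb{Q}\}$. *)

theory Defs
  imports
    "HOL-Analysis.Analysis"
    "HOL-Algebra.Generated_Groups"
begin

section \<open>The torus\<close>

definition circle_rel :: "real \<Rightarrow> real \<Rightarrow> bool" where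
  "circle_rel x y \<longleftrightarrow> (\<exists>k::int. y = x + 2 * pi * of_int k)"

quotient_type circle = real / circle_rel
proof (rule equivpI)
  show "reflp circle_rel"
    by (auto simp: reflp_def circle_rel_def intro: exI[of _ 0])
  show "symp circle_rel"
  proof (rule sympI)
    fix x y assume "circle_rel x y"
    then obtain k :: int where "y = x + 2 * pi * of_int k" by (auto simp: circle_rel_def)
    then have "x = y + 2 * pi * of_int (- k)" by simp
    then show "circle_rel y x" unfolding circle_rel_def by blast
  qed
  show "transp circle_rel"
  proof (rule transpI)
    fix x y z assume "circle_rel x y" "circle_rel y z"
    then obtain k l :: int where "y = x + 2 * pi * of_int k" "z = y + 2 * pi * of_int l"
      by (auto simp: circle_rel_def)
    then have "z = x + 2 * pi * of_int (k + l)" by (simp add: algebra_simps)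
    then show "circle_rel x z" unfolding circle_rel_def by blast
  qed
qed

type_synonym torus = "circle \<times> circle"

definition pr :: "real \<times> real \<Rightarrow> torus" where
  "pr q = (abs_circle (fst q), abs_circle (snd q))"

text \<open>The quotient topology and the quotient smooth structure: both are tested on \<open>\<real>\<^sup>2\<close>.\<close>

definition torus_open :: "torus set \<Rightarrow> bool" where
  "torus_open U \<longleftrightarrow> open (pr -` U)"

text \<open>\<open>g m n\<close> plays the role of the partial derivative of order \<open>m\<close> in the first and \<open>n\<close> in the
  second variable.  Every \<open>g m n\<close> is differentiable, so this says \<open>C\<^sup>\<infinity>\<close> on the open set \<open>W\<close>.\<close>

definition smooth_plane :: "(real \<times> real) set \<Rightarrow> (real \<times> real \<Rightarrow> real) \<Rightarrow> bool" where
  "smooth_plane W f \<longleftrightarrow>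
     (\<exists>g :: nat \<Rightarrow> nat \<Rightarrow> real \<times> real \<Rightarrow> real.
        (\<forall>q\<in>W. g 0 0 q = f q) \<and>
        (\<forall>m n. \<forall>q\<in>W. (g m n has_derivative
            (\<lambda>d. fst d * g (Suc m) n q + snd d * g m (Suc n) q)) (at q)))"

definition smooth_torus :: "torus set \<Rightarrow> (torus \<Rightarrow> real) \<Rightarrow> bool" where
  "smooth_torus U f \<longleftrightarrow> smooth_plane (pr -` U) (f \<circ> pr)"

text \<open>The coordinate fields \<open>\<partial>\<^sub>x\<close>, \<open>\<partial>\<^sub>y\<close> trivialize the tangent bundle of the torus, so that a vector
  field is a pair of functions.\<close>

definition smooth_field :: "(torus \<Rightarrow> real \<times> real) \<Rightarrow> bool" where
  "smooth_field X \<longleftrightarrow> smooth_torus UNIV (fst \<circ> X) \<and> smooth_torus UNIV (snd \<circ> X)"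

text \<open>The derivative \<open>X f\<close> at \<open>pr q\<close>.\<close>

definition lie_deriv :: "(torus \<Rightarrow> real \<times> real) \<Rightarrow> (torus \<Rightarrow> real) \<Rightarrow> real \<times> real \<Rightarrow> real" where
  "lie_deriv X f q = frechet_derivative (f \<circ> pr) (at q) (X (pr q))"


section \<open>Vector bundles over the torus\<close>

text \<open>The fibres are subspaces of one ambient real vector space, on which no topology is used.
  This loses no generality, because the direct sum of all fibres can serve as ambient space.
  The atlas consists of pairs of an open set and a local frame over it (equivalently, of local
  trivializations); the frames are indexed by the set \<open>index\<close>, whose cardinality is the rank.
  A section of the pull-back to \<open>\<real>\<^sup>2\<close> takes its value over \<open>q\<close> in \<open>fibre E (pr q)\<close>, so the fibres
  over \<open>(x + 2\<pi>m, y + 2\<pi>n)\<close> and \<open>(x, y)\<close> are literally equal.\<close>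

record ('i, 'v) vbundle =
  fibre :: "torus \<Rightarrow> 'v set"
  index :: "'i set"
  atlas :: "(torus set \<times> (torus \<Rightarrow> 'i \<Rightarrow> 'v)) set"

definition smooth_wrt ::
    "'i set \<Rightarrow> torus set \<Rightarrow> (torus \<Rightarrow> 'i \<Rightarrow> 'v::real_vector) \<Rightarrow> (torus \<Rightarrow> 'v) \<Rightarrow> bool" where
  "smooth_wrt I U e s \<longleftrightarrow>
     (\<exists>c. (\<forall>i\<in>I. smooth_torus U (c i)) \<and> (\<forall>p\<in>U. s p = (\<Sum>i\<in>I. c i p *\<^sub>R e p i)))"

definition vector_bundle :: "('i, 'v::real_vector) vbundle \<Rightarrow> bool" where
  "vector_bundle E \<longleftrightarrow>
     finite (index E) \<and>
     (\<forall>(U, e)\<in>atlas E. torus_open U \<and>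
        (\<forall>p\<in>U. inj_on (e p) (index E) \<and> independent (e p ` index E) \<and>
           span (e p ` index E) = fibre E p)) \<and>
     (\<Union>(U, e)\<in>atlas E. U) = UNIV \<and>
     (\<forall>(U, e)\<in>atlas E. \<forall>(V, e')\<in>atlas E. \<forall>j\<in>index E.
        smooth_wrt (index E) (U \<inter> V) e (\<lambda>p. e' p j))"

definition smooth_section :: "('i, 'v::real_vector) vbundle \<Rightarrow> (torus \<Rightarrow> 'v) \<Rightarrow> bool" where
  "smooth_section E s \<longleftrightarrow>
     (\<forall>p. s p \<in> fibre E p) \<and> (\<forall>(U, e)\<in>atlas E. smooth_wrt (index E) U e s)"

text \<open>\<open>(b 1, ..., b n) = (a 1, ..., a n) M\<close> with \<open>det M > 0\<close>.\<close>

definition same_orientation :: "('n::finite \<Rightarrow> 'v::real_vector) \<Rightarrow> ('n \<Rightarrow> 'v) \<Rightarrow> bool" where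
  "same_orientation a b \<longleftrightarrow>
     (\<exists>M :: real^'n^'n. det M > 0 \<and> (\<forall>j. b j = (\<Sum>i\<in>UNIV. M $ i $ j *\<^sub>R a i)))"

text \<open>An orientation is given by an atlas of positively oriented frames.\<close>

definition oriented_rank4_bundle :: "(4, 'v::real_vector) vbundle \<Rightarrow> bool" where
  "oriented_rank4_bundle E \<longleftrightarrow>
     vector_bundle E \<and> index E = UNIV \<and>
     (\<forall>(U, e)\<in>atlas E. \<forall>(V, e')\<in>atlas E. \<forall>p\<in>U \<inter> V. same_orientation (e p) (e' p))"

definition inner_on :: "'v::real_vector set \<Rightarrow> ('v \<Rightarrow> 'v \<Rightarrow> real) \<Rightarrow> bool" where
  "inner_on F k \<longleftrightarrow>
     (\<forall>u\<in>F. \<forall>v\<in>F. k u v = k v u) \<and>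
     (\<forall>u\<in>F. \<forall>v\<in>F. \<forall>w\<in>F. \<forall>a b. k (a *\<^sub>R u + b *\<^sub>R v) w = a * k u w + b * k v w) \<and>
     (\<forall>u\<in>F. u \<noteq> 0 \<longrightarrow> k u u > 0)"

definition bundle_metric ::
    "('i, 'v::real_vector) vbundle \<Rightarrow> (torus \<Rightarrow> 'v \<Rightarrow> 'v \<Rightarrow> real) \<Rightarrow> bool" where
  "bundle_metric E h \<longleftrightarrow>
     (\<forall>p. inner_on (fibre E p) (h p)) \<and>
     (\<forall>(U, e)\<in>atlas E. \<forall>i\<in>index E. \<forall>j\<in>index E. smooth_torus U (\<lambda>p. h p (e p i) (e p j)))"

type_synonym 'v connection_op = "(torus \<Rightarrow> real \<times> real) \<Rightarrow> (torus \<Rightarrow> 'v) \<Rightarrow> (torus \<Rightarrow> 'v)"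

definition is_connection ::
    "('i, 'v::real_vector) vbundle \<Rightarrow> 'v connection_op \<Rightarrow> bool" where
  "is_connection E D \<longleftrightarrow>
     (\<forall>X s. smooth_field X \<longrightarrow> smooth_section E s \<longrightarrow> smooth_section E (D X s)) \<and>
     (\<forall>X Y f g s p. smooth_field X \<longrightarrow> smooth_field Y \<longrightarrow>
        smooth_torus UNIV f \<longrightarrow> smooth_torus UNIV g \<longrightarrow> smooth_section E s \<longrightarrow>
        D (\<lambda>p. f p *\<^sub>R X p + g p *\<^sub>R Y p) s p = f p *\<^sub>R D X s p + g p *\<^sub>R D Y s p) \<and>
     (\<forall>X s t p. smooth_field X \<longrightarrow> smooth_section E s \<longrightarrow> smooth_section E t \<longrightarrow>
        D X (\<lambda>p. s p + t p) p = D X s p + D X t p) \<and>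
     (\<forall>X f s q. smooth_field X \<longrightarrow> smooth_torus UNIV f \<longrightarrow> smooth_section E s \<longrightarrow>
        D X (\<lambda>p. f p *\<^sub>R s p) (pr q) =
          lie_deriv X f q *\<^sub>R s (pr q) + f (pr q) *\<^sub>R D X s (pr q))"

definition metric_connection ::
    "('i, 'v::real_vector) vbundle \<Rightarrow> (torus \<Rightarrow> 'v \<Rightarrow> 'v \<Rightarrow> real) \<Rightarrow> 'v connection_op \<Rightarrow> bool" where
  "metric_connection E h D \<longleftrightarrow>
     is_connection E D \<and>
     (\<forall>X s t q. smooth_field X \<longrightarrow> smooth_section E s \<longrightarrow> smooth_section E t \<longrightarrow>
        lie_deriv X (\<lambda>p. h p (s p) (t p)) q =
          h (pr q) (D X s (pr q)) (t (pr q)) + h (pr q) (s (pr q)) (D X t (pr q)))"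


section \<open>The exterior square\<close>

text \<open>Bivectors over \<open>'v\<close> are realized as alternating bilinear forms on the algebraic dual of \<open>'v\<close>
  (extended by \<open>0\<close> outside the linear functionals).  The wedge products of a linearly independent
  family are linearly independent there, so the span of the \<open>wedge u v\<close> with \<open>u, v\<close> in a
  subspace is the exterior square of that subspace.\<close>

typedef (overloaded) ('v::real_vector) bivector =
  "{w :: ('v \<Rightarrow> real) \<Rightarrow> ('v \<Rightarrow> real) \<Rightarrow> real.
     (\<forall>\<alpha> \<beta>. \<not> (linear \<alpha> \<and> linear \<beta>) \<longrightarrow> w \<alpha> \<beta> = 0) \<and>
     (\<forall>\<alpha>. w \<alpha> \<alpha> = 0) \<and>
     (\<forall>\<alpha> \<beta> \<gamma> a b. linear \<alpha> \<longrightarrow> linear \<beta> \<longrightarrow> linear \<gamma> \<longrightarrow>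
        w (\<lambda>v. a * \<alpha> v + b * \<beta> v) \<gamma> = a * w \<alpha> \<gamma> + b * w \<beta> \<gamma> \<and>
        w \<gamma> (\<lambda>v. a * \<alpha> v + b * \<beta> v) = a * w \<gamma> \<alpha> + b * w \<gamma> \<beta>)}"
  morphisms biform Abs_bivector
  by (rule exI[of _ "\<lambda>_ _. 0"]) simp

setup_lifting type_definition_bivector

instantiation bivector :: (real_vector) real_vector
begin

lift_definition zero_bivector :: "'a bivector" is "\<lambda>_ _. 0"
  by simp

lift_definition plus_bivector :: "'a bivector \<Rightarrow> 'a bivector \<Rightarrow> 'a bivector"
  is "\<lambda>w z \<alpha> \<beta>. w \<alpha> \<beta> + z \<alpha> \<beta>"
  by (simp add: algebra_simps)

lift_definition minus_bivector :: "'a bivector \<Rightarrow> 'a bivector \<Rightarrow> 'a bivector"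
  is "\<lambda>w z \<alpha> \<beta>. w \<alpha> \<beta> - z \<alpha> \<beta>"
  by (simp add: algebra_simps)

lift_definition uminus_bivector :: "'a bivector \<Rightarrow> 'a bivector"
  is "\<lambda>w \<alpha> \<beta>. - w \<alpha> \<beta>"
  by (simp add: algebra_simps)

lift_definition scaleR_bivector :: "real \<Rightarrow> 'a bivector \<Rightarrow> 'a bivector"
  is "\<lambda>r w \<alpha> \<beta>. r * w \<alpha> \<beta>"
  by (simp add: algebra_simps)

instance
  by (standard; transfer) (auto simp: algebra_simps fun_eq_iff)

end

lemma linear_comb_real:
  fixes \<alpha> \<beta> :: "'v::real_vector \<Rightarrow> real"
  shows "linear \<alpha> \<Longrightarrow> linear \<beta> \<Longrightarrow> linear (\<lambda>v. a * \<alpha> v + b * \<beta> v)"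
  by (auto intro!: linearI simp: linear_add linear_scale algebra_simps)

lift_definition wedge :: "'v::real_vector \<Rightarrow> 'v \<Rightarrow> 'v bivector"
  is "\<lambda>u v \<alpha> \<beta>. if linear \<alpha> \<and> linear \<beta> then \<alpha> u * \<beta> v - \<alpha> v * \<beta> u else 0"
  by (auto simp: linear_comb_real algebra_simps)

definition ext_square_fibre :: "'v::real_vector set \<Rightarrow> 'v bivector set" where
  "ext_square_fibre F = span {wedge u v | u v. u \<in> F \<and> v \<in> F}"

text \<open>\<open><\<close> is the linear order that the numeral type \<open>4\<close> carries in the library.  In it \<open>4 = 0\<close>
  is the least element, which is irrelevant here: one wedge is taken from each pair of indices.\<close>

definition ext_square :: "(4, 'v::real_vector) vbundle \<Rightarrow> (4 \<times> 4, 'v bivector) vbundle" where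
  "ext_square E =
     \<lparr> fibre = (\<lambda>p. ext_square_fibre (fibre E p)),
       index = {(i, j). i < j},
       atlas = (\<lambda>(U, e). (U, \<lambda>p (i, j). wedge (e p i) (e p j))) ` atlas E \<rparr>"

text \<open>The metric on the exterior square of \<open>F\<close> that is induced by an inner product on \<open>F\<close>; its
  values on the exterior square are determined by its values on wedge products.\<close>

definition ext_square_metric ::
    "'v::real_vector set \<Rightarrow> ('v \<Rightarrow> 'v \<Rightarrow> real) \<Rightarrow> ('v bivector \<Rightarrow> 'v bivector \<Rightarrow> real) \<Rightarrow> bool" where
  "ext_square_metric F k K \<longleftrightarrow>
     inner_on (ext_square_fibre F) K \<and>
     (\<forall>u\<in>F. \<forall>v\<in>F. \<forall>w\<in>F. \<forall>z\<in>F.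
        K (wedge u v) (wedge w z) = k u w * k v z - k u z * k v w)"

definition induced_connection ::
    "(4, 'v::real_vector) vbundle \<Rightarrow> 'v connection_op \<Rightarrow> 'v bivector connection_op \<Rightarrow> bool" where
  "induced_connection E D D' \<longleftrightarrow>
     is_connection (ext_square E) D' \<and>
     (\<forall>X s t p. smooth_field X \<longrightarrow> smooth_section E s \<longrightarrow> smooth_section E t \<longrightarrow>
        D' X (\<lambda>p. wedge (s p) (t p)) p = wedge (D X s p) (t p) + wedge (s p) (D X t p))"


section \<open>The self-dual and the anti-self-dual subbundle\<close>

text \<open>From here on the sign \<open>\<epsilon>\<close> is the real number \<open>1\<close> or \<open>-1\<close>.\<close>

definition orthonormal :: "('v \<Rightarrow> 'v \<Rightarrow> real) \<Rightarrow> ('n \<Rightarrow> 'v) \<Rightarrow> bool" where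
  "orthonormal k b \<longleftrightarrow> (\<forall>i j. k (b i) (b j) = (if i = j then 1 else 0))"

definition positive_orthonormal_basis ::
    "(4, 'v::real_vector) vbundle \<Rightarrow> (torus \<Rightarrow> 'v \<Rightarrow> 'v \<Rightarrow> real) \<Rightarrow> torus \<Rightarrow> (4 \<Rightarrow> 'v) \<Rightarrow> bool" where
  "positive_orthonormal_basis E h p b \<longleftrightarrow>
     (\<exists>(U, e)\<in>atlas E. p \<in> U \<and> same_orientation (e p) b) \<and> orthonormal (h p) b"

definition Omega :: "real \<Rightarrow> (4 \<Rightarrow> 'v::real_vector) \<Rightarrow> 3 \<Rightarrow> 'v bivector" where
  "Omega \<epsilon> b i = (1 / sqrt 2) *\<^sub>R
     (if i = 1 then wedge (b 1) (b 2) + \<epsilon> *\<^sub>R wedge (b 3) (b 4)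
      else if i = 2 then wedge (b 1) (b 3) + \<epsilon> *\<^sub>R wedge (b 4) (b 2)
      else wedge (b 1) (b 4) + \<epsilon> *\<^sub>R wedge (b 2) (b 3))"

text \<open>The fibre does not depend on the choice of the positive orthonormal basis \<open>b\<close>.\<close>

definition Lambda_fibre ::
    "(4, 'v::real_vector) vbundle \<Rightarrow> (torus \<Rightarrow> 'v \<Rightarrow> 'v \<Rightarrow> real) \<Rightarrow> real \<Rightarrow> torus \<Rightarrow> 'v bivector set" where
  "Lambda_fibre E h \<epsilon> p =
     {w. \<exists>b. positive_orthonormal_basis E h p b \<and> w \<in> span (range (Omega \<epsilon> b))}"

definition Lambda_positive_orthonormal_basis ::
    "(4, 'v::real_vector) vbundle \<Rightarrow> (torus \<Rightarrow> 'v \<Rightarrow> 'v \<Rightarrow> real) \<Rightarrow> real \<Rightarrow> torus \<Rightarrow>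
     (3 \<Rightarrow> 'v bivector) \<Rightarrow> bool" where
  "Lambda_positive_orthonormal_basis E h \<epsilon> p \<omega> \<longleftrightarrow>
     (\<forall>i. \<omega> i \<in> Lambda_fibre E h \<epsilon> p) \<and>
     (\<exists>K. ext_square_metric (fibre E p) (h p) K \<and> orthonormal K \<omega>) \<and>
     (\<exists>b. positive_orthonormal_basis E h p b \<and> same_orientation (Omega \<epsilon> b) \<omega>)"


section \<open>Parallel sections along the axes\<close>

text \<open>\<open>\<psi>\<close> is a section of the pull-back bundle along the line \<open>t \<mapsto> t v\<close> in the plane, and \<open>\<xi>\<close> is its
  covariant derivative at the parameter \<open>a\<close>.  Near \<open>a\<close> the section is written as
  \<open>\<psi> t = \<Sum>\<^sub>k c\<^sub>k(t) w\<^sub>k(pr (t v))\<close> with global smooth sections \<open>w\<^sub>k\<close>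
  (extensions of a local frame suffice);
  the Leibniz rule then gives \<open>\<Sum>\<^sub>k c\<^sub>k'(a) w\<^sub>k + c\<^sub>k(a) D\<^sub>v w\<^sub>k\<close> at \<open>pr (a v)\<close>, where \<open>v\<close> is also
  regarded as a constant vector field.  The result is independent of the representation.\<close>

definition has_cov_deriv ::
    "('i, 'w::real_vector) vbundle \<Rightarrow> 'w connection_op \<Rightarrow> real \<times> real \<Rightarrow> (real \<Rightarrow> 'w) \<Rightarrow> 'w \<Rightarrow> real \<Rightarrow> bool"
  where
  "has_cov_deriv B D v \<psi> \<xi> a \<longleftrightarrow>
     (\<exists>(n::nat) (c :: nat \<Rightarrow> real \<Rightarrow> real) (c' :: nat \<Rightarrow> real) (w :: nat \<Rightarrow> torus \<Rightarrow> 'w).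
        (\<forall>k<n. smooth_section B (w k) \<and> (c k has_real_derivative c' k) (at a)) \<and>
        (\<forall>\<^sub>F t in nhds a. \<psi> t = (\<Sum>k<n. c k t *\<^sub>R w k (pr (t *\<^sub>R v)))) \<and>
        \<xi> = (\<Sum>k<n. c' k *\<^sub>R w k (pr (a *\<^sub>R v)) + c k a *\<^sub>R D (\<lambda>_. v) (w k) (pr (a *\<^sub>R v))))"

text \<open>\<open>\<Omega> a i\<close> is the \<open>i\<close>-th parallel section at \<open>a v\<close>; the \<open>x\<close>-axis is \<open>v = (1, 0)\<close>, the \<open>y\<close>-axis
  \<open>v = (0, 1)\<close>.\<close>

definition parallel_frame ::
    "(4, 'v::real_vector) vbundle \<Rightarrow> (torus \<Rightarrow> 'v \<Rightarrow> 'v \<Rightarrow> real) \<Rightarrow> 'v bivector connection_op \<Rightarrow>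
     real \<Rightarrow> (3 \<Rightarrow> 'v bivector) \<Rightarrow> real \<times> real \<Rightarrow> (real \<Rightarrow> 3 \<Rightarrow> 'v bivector) \<Rightarrow> bool" where
  "parallel_frame E h D' \<epsilon> \<omega> v \<Omega> \<longleftrightarrow>
     (\<forall>i. \<Omega> 0 i = \<omega> i) \<and>
     (\<forall>i a. \<Omega> a i \<in> Lambda_fibre E h \<epsilon> (pr (a *\<^sub>R v))) \<and>
     (\<forall>i a. has_cov_deriv (ext_square E) D' v (\<lambda>t. \<Omega> t i) 0 a)"

text \<open>\<open>C\<close> is the matrix with \<open>\<Omega> (a + 2\<pi>) = \<Omega> a C\<close> (row vector times matrix) for the frame \<open>\<Omega>\<close> of
  parallel sections with initial value \<open>\<omega>\<close>.  That frame exists and is unique.\<close>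

definition holonomy_matrix ::
    "(4, 'v::real_vector) vbundle \<Rightarrow> (torus \<Rightarrow> 'v \<Rightarrow> 'v \<Rightarrow> real) \<Rightarrow> 'v bivector connection_op \<Rightarrow>
     real \<Rightarrow> (3 \<Rightarrow> 'v bivector) \<Rightarrow> real \<times> real \<Rightarrow> real^3^3 \<Rightarrow> bool" where
  "holonomy_matrix E h D' \<epsilon> \<omega> v C \<longleftrightarrow>
     rotation_matrix C \<and>
     (\<exists>\<Omega>. parallel_frame E h D' \<epsilon> \<omega> v \<Omega>) \<and>
     (\<forall>\<Omega>. parallel_frame E h D' \<epsilon> \<omega> v \<Omega> \<longrightarrow>
        (\<forall>a i. \<Omega> (a + 2 * pi) i = (\<Sum>j\<in>UNIV. C $ j $ i *\<^sub>R \<Omega> a j)))"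


section \<open>The topological holonomy group\<close>

definition SO3 :: "(real^3^3) monoid" where
  "SO3 = \<lparr> carrier = {A. rotation_matrix A}, mult = (**), one = mat 1 \<rparr>"

definition topological_holonomy_group ::
    "(4, 'v::real_vector) vbundle \<Rightarrow> (torus \<Rightarrow> 'v \<Rightarrow> 'v \<Rightarrow> real) \<Rightarrow> 'v bivector connection_op \<Rightarrow>
     real \<Rightarrow> (3 \<Rightarrow> 'v bivector) \<Rightarrow> (real^3^3) set" where
  "topological_holonomy_group E h D' \<epsilon> \<omega> =
     generate SO3 {C. holonomy_matrix E h D' \<epsilon> \<omega> (1, 0) C \<or> holonomy_matrix E h D' \<epsilon> \<omega> (0, 1) C}"

definition finite_order :: "real^3^3 \<Rightarrow> bool" where
  "finite_order A \<longleftrightarrow> (\<exists>n::nat. n > 0 \<and> A [^]\<^bsub>SO3\<^esub> n = \<one>\<^bsub>SO3\<^esub>)"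

definition rot_first_axis :: "real \<Rightarrow> real^3^3" where
  "rot_first_axis \<theta> =
     vector [vector [1, 0, 0], vector [0, cos \<theta>, - sin \<theta>], vector [0, sin \<theta>, cos \<theta>]]"

definition vec_angle :: "'a::real_inner \<Rightarrow> 'a \<Rightarrow> real" where
  "vec_angle u v = arccos (u \<bullet> v / (norm u * norm v))"

definition f_trace :: "real \<Rightarrow> real \<Rightarrow> real \<Rightarrow> real" where
  "f_trace \<theta>\<^sub>1 \<theta>\<^sub>2 \<phi> =
     cos \<theta>\<^sub>1 * cos \<theta>\<^sub>2 - 2 * sin \<theta>\<^sub>1 * sin \<theta>\<^sub>2 * cos \<phi> +
     (1 + cos \<theta>\<^sub>1 * cos \<theta>\<^sub>2) * (cos \<phi>)\<^sup>2 + (cos \<theta>\<^sub>1 + cos \<theta>\<^sub>2) * (sin \<phi>)\<^sup>2"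

definition I_range :: "real \<Rightarrow> real \<Rightarrow> real set" where
  "I_range \<theta>\<^sub>1 \<theta>\<^sub>2 = f_trace \<theta>\<^sub>1 \<theta>\<^sub>2 ` {0<..pi / 2}"

definition S_set :: "real set" where
  "S_set = {1 + 2 * cos (q * pi) | q. q \<in> \<rat>}"

end

theory Submission
  imports Defs
begin

text \<open>The two generators have finite order because their angles are rational multiples of \<open>\<pi>\<close>.
  That they generate the group amounts to the uniqueness of the holonomy matrix along each axis
  (\<open>holonomy_matrix_unique\<close>). The rest is about rotations of three-space.

  For a rotation \<open>A\<close> with trace \<open>1 + 2 cos \<theta>\<close>, Cayley-Hamilton gives
  \<open>trace (A\<^sup>n) = 1 + 2 cos (n \<theta>)\<close> without any choice of an axis; if \<open>A\<^sup>n\<close> is the identity, then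
  \<open>cos (n \<theta>) = 1\<close> and \<open>\<theta>\<close> is a rational multiple of \<open>\<pi>\<close>. So the trace of a rotation of finite order
  lies in \<open>S_set\<close> (\<open>finite_order_trace_in_S_set\<close>). The value of \<open>f_trace\<close> is the common trace of
  \<open>C\<^sub>1 C\<^sub>2\<close> and \<open>C\<^sub>2 C\<^sub>1\<close> (\<open>trace_two_rotations\<close>), hence both products have infinite order.

  Suppose that \<open>C\<^sub>1 C\<^sub>2\<close> and \<open>C\<^sub>2 C\<^sub>1\<close> commute. Both have infinite order, so they have the same axis.
  Conjugation by \<open>C\<^sub>2\<close>, and likewise by the inverse of \<open>C\<^sub>1\<close>, takes \<open>C\<^sub>1 C\<^sub>2\<close> to \<open>C\<^sub>2 C\<^sub>1\<close>. Hence both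
  rotations take the axial vector of \<open>C\<^sub>1 C\<^sub>2\<close> to plus itself, or both to minus itself
  (\<open>commuting_products_common_eigenvector\<close>). In the first case the two rotations have the same axis,
  which contradicts \<open>0 < \<phi> \<le> \<pi> / 2\<close>. In the second case both are half-turns, and
  \<open>q\<^sub>1 = q\<^sub>2 = 1\<close> would be integers.\<close>


section \<open>Uniqueness of the holonomy matrices\<close>

lemma same_orientation_in_span:
  assumes "same_orientation a b"
  shows "b j \<in> span (range a)"
proof -
  obtain M :: "real^'a^'a" where "b j = (\<Sum>i\<in>UNIV. M $ i $ j *\<^sub>R a i)"
    using assms unfolding same_orientation_def by blast
  then show ?thesis
    by (simp add: span_sum span_scale span_base)
qed

lemma Lambda_fibre_subset_ext_square_fibre:
  assumes E: "oriented_rank4_bundle E"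
  shows "Lambda_fibre E h \<epsilon> p \<subseteq> ext_square_fibre (fibre E p)"
proof
  fix w assume "w \<in> Lambda_fibre E h \<epsilon> p"
  then obtain b where b: "positive_orthonormal_basis E h p b"
    and w: "w \<in> span (range (Omega \<epsilon> b))"
    unfolding Lambda_fibre_def by blast
  obtain U e where Ue: "(U, e) \<in> atlas E" "p \<in> U" and so: "same_orientation (e p) b"
    using b unfolding positive_orthonormal_basis_def by blast
  have "span (e p ` index E) = fibre E p" "index E = UNIV"
    using E Ue unfolding oriented_rank4_bundle_def vector_bundle_def by blast+
  then have b_in: "b j \<in> fibre E p" for j
    using same_orientation_in_span[OF so] by metis
  have wedge_in: "wedge (b i) (b j) \<in> ext_square_fibre (fibre E p)" for i j
    unfolding ext_square_fibre_def using b_in by (intro span_base) blast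
  have "Omega \<epsilon> b i \<in> ext_square_fibre (fibre E p)" for i
    using wedge_in unfolding Omega_def ext_square_fibre_def
    by (auto intro!: span_add span_scale)
  then have "span (range (Omega \<epsilon> b)) \<subseteq> ext_square_fibre (fibre E p)"
    unfolding ext_square_fibre_def by (intro span_minimal subspace_span) auto
  then show "w \<in> ext_square_fibre (fibre E p)"
    using w by blast
qed

lemma orthonormal_combination:
  fixes \<omega> :: "3 \<Rightarrow> 'w::real_vector"
  assumes K: "inner_on F K" and F: "subspace F"
    and \<omega>: "\<And>j. \<omega> j \<in> F" and on: "orthonormal K \<omega>"
  shows "K (\<Sum>j\<in>UNIV. c j *\<^sub>R \<omega> j) (\<omega> i) = c i"
proof -
  have lin: "K (a *\<^sub>R u + b *\<^sub>R v) w = a * K u w + b * K v w"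
    if "u \<in> F" "v \<in> F" "w \<in> F" for a b u v w
    using K that unfolding inner_on_def by blast
  define z where "z = c 2 *\<^sub>R \<omega> 2 + c 3 *\<^sub>R \<omega> 3"
  have z: "z \<in> F"
    unfolding z_def using F \<omega> by (intro subspace_add subspace_scale)
  have "(\<Sum>j\<in>UNIV. c j *\<^sub>R \<omega> j) = c 1 *\<^sub>R \<omega> 1 + 1 *\<^sub>R z"
    by (simp add: sum_3 z_def)
  then have "K (\<Sum>j\<in>UNIV. c j *\<^sub>R \<omega> j) (\<omega> i) = c 1 * K (\<omega> 1) (\<omega> i) + 1 * K z (\<omega> i)"
    using lin \<omega> z by presburger
  also have "K z (\<omega> i) = c 2 * K (\<omega> 2) (\<omega> i) + c 3 * K (\<omega> 3) (\<omega> i)"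
    unfolding z_def using lin \<omega> by presburger
  finally show ?thesis
    using on exhaust_3[of i] unfolding orthonormal_def by auto
qed

text \<open>The parallel frame exists, and at \<open>a = 0\<close> its translate by a period is \<open>\<omega> C\<close>; since \<open>\<omega>\<close> is
  orthonormal, the entries of \<open>C\<close> are the coordinates of that translate.\<close>

lemma holonomy_matrix_unique:
  assumes E: "oriented_rank4_bundle E"
    and \<omega>: "Lambda_positive_orthonormal_basis E h \<epsilon> p \<omega>"
    and A: "holonomy_matrix E h D' \<epsilon> \<omega> v A" and B: "holonomy_matrix E h D' \<epsilon> \<omega> v B"
  shows "A = B"
proof -
  obtain \<Omega> where \<Omega>: "parallel_frame E h D' \<epsilon> \<omega> v \<Omega>"
    using A unfolding holonomy_matrix_def by blast
  have \<Omega>0: "\<Omega> 0 j = \<omega> j" for j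
    using \<Omega> unfolding parallel_frame_def by blast
  have "\<Omega> (0 + 2 * pi) i = (\<Sum>j\<in>UNIV. A $ j $ i *\<^sub>R \<Omega> 0 j)"
       "\<Omega> (0 + 2 * pi) i = (\<Sum>j\<in>UNIV. B $ j $ i *\<^sub>R \<Omega> 0 j)" for i
    using A B \<Omega> unfolding holonomy_matrix_def by blast+
  then have eq: "(\<Sum>j\<in>UNIV. A $ j $ i *\<^sub>R \<omega> j) = (\<Sum>j\<in>UNIV. B $ j $ i *\<^sub>R \<omega> j)" for i
    unfolding \<Omega>0 by metis
  let ?F = "ext_square_fibre (fibre E p)"
  obtain K where K: "ext_square_metric (fibre E p) (h p) K" "orthonormal K \<omega>"
    using \<omega> unfolding Lambda_positive_orthonormal_basis_def by blast
  have K': "inner_on ?F K"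
    using K unfolding ext_square_metric_def by blast
  have F: "subspace ?F"
    unfolding ext_square_fibre_def by (rule subspace_span)
  have mem: "\<omega> j \<in> ?F" for j
    using \<omega> Lambda_fibre_subset_ext_square_fibre[OF E]
    unfolding Lambda_positive_orthonormal_basis_def by blast
  have "A $ j $ i = B $ j $ i" for i j
    using orthonormal_combination[OF K' F mem K(2), of "\<lambda>j. A $ j $ i" j]
      orthonormal_combination[OF K' F mem K(2), of "\<lambda>j. B $ j $ i" j] eq[of i] by simp
  then show ?thesis
    by (simp add: vec_eq_iff)
qed


section \<open>Traces of rotations of finite order\<close>

lemma rotation_matrix_mult:
  fixes A B :: "real^'n^'n"
  assumes "rotation_matrix A" "rotation_matrix B"
  shows "rotation_matrix (A ** B)"
  using assms by (simp add: rotation_matrix_def orthogonal_matrix_mul det_mul)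

lemma rotation_matrix_transpose_mult:
  fixes A :: "real^'n^'n"
  assumes "rotation_matrix A"
  shows "transpose A ** A = mat 1" "A ** transpose A = mat 1"
  using assms by (simp_all add: rotation_matrix_def orthogonal_matrix_def)

text \<open>A rotation respects cross products, so each of its columns is the cross product of the two
  others.\<close>

lemma rotation_matrix_eq_cofactors:
  fixes A :: "real^3^3"
  assumes "rotation_matrix A"
  shows "A$1$1 = A$2$2 * A$3$3 - A$3$2 * A$2$3" "A$2$1 = A$3$2 * A$1$3 - A$1$2 * A$3$3"
    "A$3$1 = A$1$2 * A$2$3 - A$2$2 * A$1$3" "A$1$2 = A$2$3 * A$3$1 - A$3$3 * A$2$1"
    "A$2$2 = A$3$3 * A$1$1 - A$1$3 * A$3$1" "A$3$2 = A$1$3 * A$2$1 - A$2$3 * A$1$1"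
    "A$1$3 = A$2$1 * A$3$2 - A$3$1 * A$2$2" "A$2$3 = A$3$1 * A$1$2 - A$1$1 * A$3$2"
    "A$3$3 = A$1$1 * A$2$2 - A$2$1 * A$1$2"
proof -
  have "cross3 (A *v x) (A *v y) = A *v cross3 x y" for x y
    using assms by (rule cross_rotation_matrix)
  from this[of "axis 2 1" "axis 3 1"] this[of "axis 3 1" "axis 1 1"] this[of "axis 1 1" "axis 2 1"]
  show "A$1$1 = A$2$2 * A$3$3 - A$3$2 * A$2$3" "A$2$1 = A$3$2 * A$1$3 - A$1$2 * A$3$3"
    "A$3$1 = A$1$2 * A$2$3 - A$2$2 * A$1$3" "A$1$2 = A$2$3 * A$3$1 - A$3$3 * A$2$1"
    "A$2$2 = A$3$3 * A$1$1 - A$1$3 * A$3$1" "A$3$2 = A$1$3 * A$2$1 - A$2$3 * A$1$1"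
    "A$1$3 = A$2$1 * A$3$2 - A$3$1 * A$2$2" "A$2$3 = A$3$1 * A$1$2 - A$1$1 * A$3$2"
    "A$3$3 = A$1$1 * A$2$2 - A$2$1 * A$1$2"
    by (simp_all add: vec_eq_iff forall_3 cross3_def matrix_vector_mult_def sum_3 axis_def)
qed

text \<open>This is the Cayley-Hamilton theorem divided by \<open>A\<close>: the cofactor matrix of a rotation \<open>A\<close> is
  \<open>A\<close> itself, so the sum of the principal minors equals the trace and the inverse is the
  transpose.\<close>

lemma rotation_matrix_square:
  fixes A :: "real^3^3"
  assumes "rotation_matrix A"
  shows "A ** A + trace A *\<^sub>R mat 1 = trace A *\<^sub>R A + transpose A"
proof -
  note cof = rotation_matrix_eq_cofactors[OF assms]
  let ?t = "A$1$1 + A$2$2 + A$3$3"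
  have "A$1$1 * A$1$1 + A$1$2 * A$2$1 + A$1$3 * A$3$1 + ?t = ?t * A$1$1 + A$1$1"
    using cof(5,9) by algebra
  moreover
  have "A$1$1 * A$1$2 + A$1$2 * A$2$2 + A$1$3 * A$3$2 = ?t * A$1$2 + A$2$1"
    using cof(2) by algebra
  moreover
  have "A$1$1 * A$1$3 + A$1$2 * A$2$3 + A$1$3 * A$3$3 = ?t * A$1$3 + A$3$1"
    using cof(3) by algebra
  moreover
  have "A$2$1 * A$1$1 + A$2$2 * A$2$1 + A$2$3 * A$3$1 = ?t * A$2$1 + A$1$2"
    using cof(4) by algebra
  moreover
  have "A$2$1 * A$1$2 + A$2$2 * A$2$2 + A$2$3 * A$3$2 + ?t = ?t * A$2$2 + A$2$2"
    using cof(1,9) by algebra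
  moreover
  have "A$2$1 * A$1$3 + A$2$2 * A$2$3 + A$2$3 * A$3$3 = ?t * A$2$3 + A$3$2"
    using cof(6) by algebra
  moreover
  have "A$3$1 * A$1$1 + A$3$2 * A$2$1 + A$3$3 * A$3$1 = ?t * A$3$1 + A$1$3"
    using cof(7) by algebra
  moreover
  have "A$3$1 * A$1$2 + A$3$2 * A$2$2 + A$3$3 * A$3$2 = ?t * A$3$2 + A$2$3"
    using cof(8) by algebra
  moreover
  have "A$3$1 * A$1$3 + A$3$2 * A$2$3 + A$3$3 * A$3$3 + ?t = ?t * A$3$3 + A$3$3"
    using cof(1,5) by algebra
  ultimately show ?thesis
    by (simp add: vec_eq_iff forall_3 matrix_matrix_mult_def sum_3 trace_def mat_def transpose_def)
qed

text \<open>The four quantities \<open>1 + a + b + c\<close>, \<open>1 + a - b - c\<close>, \<open>1 - a + b - c\<close>, \<open>1 - a - b + c\<close> formed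
  from the diagonal entries are four times the squares of the coordinates of a unit quaternion.
  Without the quaternion: the product of the first, \<open>1 + t\<close>, with any other one is the square of a
  difference of two off-diagonal entries. The other three add up to \<open>3 - t\<close>, so
  \<open>(1 + t) (3 - t) \<ge> 0\<close>.\<close>

lemma rotation_matrix_trace_bounds:
  fixes A :: "real^3^3"
  assumes "rotation_matrix A"
  shows "- 1 \<le> trace A" "trace A \<le> 3"
proof -
  define t where "t = trace A"
  have t: "t = A$1$1 + A$2$2 + A$3$3"
    by (simp add: t_def trace_def sum_3)
  have orth: "transpose A ** A = mat 1" "A ** transpose A = mat 1"
    using rotation_matrix_transpose_mult[OF assms] by simp_all
  then have col: "(A$1$1)\<^sup>2 + (A$2$1)\<^sup>2 + (A$3$1)\<^sup>2 = 1" "(A$1$2)\<^sup>2 + (A$2$2)\<^sup>2 + (A$3$2)\<^sup>2 = 1"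
      "(A$1$3)\<^sup>2 + (A$2$3)\<^sup>2 + (A$3$3)\<^sup>2 = 1"
    and row: "(A$1$1)\<^sup>2 + (A$1$2)\<^sup>2 + (A$1$3)\<^sup>2 = 1" "(A$2$1)\<^sup>2 + (A$2$2)\<^sup>2 + (A$2$3)\<^sup>2 = 1"
      "(A$3$1)\<^sup>2 + (A$3$2)\<^sup>2 + (A$3$3)\<^sup>2 = 1"
    by (simp_all add: vec_eq_iff forall_3 matrix_matrix_mult_def sum_3 mat_def transpose_def
        power2_eq_square)
  note cof = rotation_matrix_eq_cofactors[OF assms]
  have 1: "(1 + t) * (1 + A$1$1 - A$2$2 - A$3$3) = (A$3$2 - A$2$3)\<^sup>2"
    using cof(1) col row unfolding t by algebra
  have 2: "(1 + t) * (1 - A$1$1 + A$2$2 - A$3$3) = (A$1$3 - A$3$1)\<^sup>2"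
    using cof(5) col row unfolding t by algebra
  have 3: "(1 + t) * (1 - A$1$1 - A$2$2 + A$3$3) = (A$2$1 - A$1$2)\<^sup>2"
    using cof(9) col row unfolding t by algebra
  have "(1 + t) * (3 - t) \<ge> 0"
  proof -
    have "(1 + t) * (3 - t) = (A$3$2 - A$2$3)\<^sup>2 + (A$1$3 - A$3$1)\<^sup>2 + (A$2$1 - A$1$2)\<^sup>2"
      unfolding 1[symmetric] 2[symmetric] 3[symmetric] t by algebra
    then show ?thesis by simp
  qed
  then show "- 1 \<le> trace A" "trace A \<le> 3"
    unfolding t_def[symmetric] by (auto simp: zero_le_mult_iff)
qed

lemma trace_scaleR: "trace (c *\<^sub>R (A :: real^'n^'n)) = c * trace A"
  by (simp add: trace_def sum_distrib_left)

text \<open>Both sides satisfy the linear recurrence with characteristic polynomial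
  \<open>X\<^sup>3 - t X\<^sup>2 + t X - 1\<close>, where \<open>t = 1 + 2 cos \<theta>\<close>: the left-hand side by Cayley-Hamilton, the
  right-hand side because the roots are \<open>1\<close> and \<open>exp (\<plusminus> i \<theta>)\<close>.\<close>

lemma trace_rotation_power:
  assumes A: "rotation_matrix A" and t: "trace A = 1 + 2 * cos \<theta>"
  shows "trace (A [^]\<^bsub>SO3\<^esub> (n::nat)) = 1 + 2 * cos (real n * \<theta>)"
proof -
  let ?t = "trace A"
  let ?P = "\<lambda>n::nat. A [^]\<^bsub>SO3\<^esub> n"
  have P0: "?P 0 = mat 1" and PS: "?P (Suc n) = ?P n ** A" for n
    by (simp_all add: SO3_def)
  \<comment> \<open>As rewrite rules these would turn powers into the generic product of a monoid instead of the matrix product.\<close>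
  note [simp del] = nat_pow_0 nat_pow_Suc
  note sq = rotation_matrix_square[OF A]
  have rec: "trace (?P (n + 3)) = ?t * trace (?P (n + 2)) - ?t * trace (?P (n + 1)) + trace (?P n)" for n
  proof -
    have "?P (n + 1) ** (A ** A + ?t *\<^sub>R mat 1) = ?P (n + 1) ** (?t *\<^sub>R A + transpose A)"
      by (simp only: sq)
    moreover have "?P (n + 1) ** transpose A = ?P n"
      unfolding Suc_eq_plus1[symmetric] PS
      by (simp only: matrix_mul_assoc[symmetric] rotation_matrix_transpose_mult[OF A] matrix_mul_rid)
    ultimately have "?P (n + 3) + ?t *\<^sub>R ?P (n + 1) = ?t *\<^sub>R ?P (n + 2) + ?P n"
      by (simp add: PS numeral_3_eq_3 numeral_2_eq_2 matrix_mul_assoc matrix_add_ldistrib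
          matrix_scalar_ac flip: scalar_matrix_assoc)
    then have "trace (?P (n + 3) + ?t *\<^sub>R ?P (n + 1)) = trace (?t *\<^sub>R ?P (n + 2) + ?P n)"
      by (rule arg_cong)
    then show ?thesis
      by (simp add: trace_add trace_scaleR)
  qed
  have step: "cos (real (n + 2) * \<theta>) = 2 * cos \<theta> * cos (real (n + 1) * \<theta>) - cos (real n * \<theta>)" for n
  proof -
    have "real (n + 2) * \<theta> = real (n + 1) * \<theta> + \<theta>" "real n * \<theta> = real (n + 1) * \<theta> - \<theta>"
      by (simp_all add: algebra_simps)
    then show ?thesis
      by (simp only: cos_add cos_diff) simp
  qed
  show ?thesis
  proof (induction n rule: less_induct)
    case (less n)
    have "n = 0 \<or> n = 1 \<or> n = 2 \<or> n = n - 3 + 3"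
      by linarith
    then consider "n = 0" | "n = 1" | "n = 2" | m where "n = m + 3"
      by metis
    then show ?case
    proof cases
      case 1
      then show ?thesis
        by (simp add: P0 trace_I)
    next
      case 2
      then show ?thesis
        using t PS[of 0] by (simp add: P0)
    next
      case 3
      have "?P 2 = A ** A"
        by (simp add: numeral_2_eq_2 PS P0)
      moreover have "trace (A ** A) + ?t * 3 = ?t * ?t + ?t"
        using arg_cong[OF sq, of trace]
        by (simp add: trace_add trace_scaleR trace_I) (simp add: trace_def transpose_def)
      moreover have "cos (2 * \<theta>) = 2 * cos \<theta> * cos \<theta> - 1"
        using step[of 0] by simp
      ultimately show ?thesis
        using 3 unfolding t by (simp add: algebra_simps)
    next
      case 4
      have "trace (?P n) = ?t * (1 + 2 * cos (real (m + 2) * \<theta>))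
          - ?t * (1 + 2 * cos (real (m + 1) * \<theta>)) + (1 + 2 * cos (real m * \<theta>))"
        using rec[of m] less.IH[of "m + 2"] less.IH[of "m + 1"] less.IH[of m] 4 by simp
      also have "\<dots> = 1 + 2 * cos (real (m + 1 + 2) * \<theta>)"
        using step[of m] step[of "m + 1"] unfolding t by (simp add: algebra_simps)
      finally show ?thesis
        using 4 by (simp add: add.commute)
    qed
  qed
qed

lemma finite_order_trace_in_S_set:
  assumes A: "rotation_matrix A" and "finite_order A"
  shows "trace A \<in> S_set"
proof -
  define \<theta> where "\<theta> = arccos ((trace A - 1) / 2)"
  have t: "trace A = 1 + 2 * cos \<theta>"
    using rotation_matrix_trace_bounds[OF A] by (simp add: \<theta>_def field_simps)
  obtain n :: nat where n: "n > 0" "A [^]\<^bsub>SO3\<^esub> n = \<one>\<^bsub>SO3\<^esub>"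
    using assms unfolding finite_order_def by blast
  then have "1 + 2 * cos (real n * \<theta>) = trace (mat 1 :: real^3^3)"
    using trace_rotation_power[OF A t, of n] by (simp add: SO3_def)
  then have "cos (real n * \<theta>) = 1"
    by (simp add: trace_I)
  then obtain k :: int where "real n * \<theta> = of_int k * 2 * pi"
    unfolding cos_one_2pi_int by auto
  then have "\<theta> = (2 * real_of_int k / real n) * pi"
    using n by (simp add: field_simps)
  moreover have "2 * real_of_int k / real n \<in> \<rat>"
    by simp
  ultimately show ?thesis
    unfolding S_set_def t by blast
qed


section \<open>The axial vector\<close>

text \<open>For a rotation by \<open>\<theta>\<close> about the unit vector \<open>u\<close> this is \<open>2 sin \<theta> u\<close>.\<close>

definition axial :: "real^3^3 \<Rightarrow> real^3" where
  "axial A = vector [A$3$2 - A$2$3, A$1$3 - A$3$1, A$2$1 - A$1$2]"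

lemma cross_axial: "cross3 (axial A) x = A *v x - transpose A *v x"
  by (simp add: axial_def cross3_def vec_eq_iff forall_3 matrix_vector_mult_def sum_3
      transpose_def algebra_simps)

lemma axial_conjugate:
  assumes P: "rotation_matrix P"
  shows "axial (P ** A ** transpose P) = P *v axial A"
proof -
  let ?M = "P ** A ** transpose P"
  have "cross3 (axial ?M) x = cross3 (P *v axial A) x" for x
  proof -
    have "cross3 (axial ?M) x = P *v (A *v (transpose P *v x) - transpose A *v (transpose P *v x))"
      by (simp add: cross_axial matrix_transpose_mul matrix_vector_mul_assoc matrix_mul_assoc
          matrix_vector_mult_diff_distrib del: transpose_matrix_vector)
    also have "\<dots> = P *v cross3 (axial A) (transpose P *v x)"
      by (simp only: cross_axial)
    also have "\<dots> = cross3 (P *v axial A) (P *v (transpose P *v x))"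
      using P by (simp add: cross_rotation_matrix)
    finally show ?thesis
      by (simp add: matrix_vector_mul_assoc rotation_matrix_transpose_mult[OF P]
          del: transpose_matrix_vector)
  qed
  from this[of "axis 1 1"] this[of "axis 2 1"] show ?thesis
    by (simp add: cross3_def vec_eq_iff forall_3 axis_def)
qed

lemma rotation_matrix_transpose_eq_iff:
  fixes P :: "real^'n^'n"
  assumes "rotation_matrix P"
  shows "transpose P *v y = x \<longleftrightarrow> P *v x = y"
  using rotation_matrix_transpose_mult[OF assms]
  by (metis matrix_vector_mul_assoc matrix_vector_mul_lid)

lemma rotation_matrix_inner:
  fixes P :: "real^'n^'n"
  assumes "rotation_matrix P"
  shows "(P *v x) \<bullet> (P *v x) = x \<bullet> x"
proof -
  have "(P *v x) \<bullet> (P *v x) = (transpose P *v (P *v x)) \<bullet> x"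
    by (simp add: dot_lmul_matrix)
  also have "transpose P *v (P *v x) = x"
    using rotation_matrix_transpose_eq_iff[OF assms] by blast
  finally show ?thesis .
qed

text \<open>A fixed vector of a rotation is fixed by the transpose, too, and its cross product with the
  axial vector is the difference of the two images.\<close>

lemma axial_cross_fixed:
  assumes B: "rotation_matrix B" and x: "B *v x = x"
  shows "cross3 (axial B) x = 0"
  using rotation_matrix_transpose_eq_iff[OF B, of x x] x
  by (simp add: cross_axial del: transpose_matrix_vector)

lemma axial_zero_finite_order:
  assumes A: "rotation_matrix A" and "axial A = 0"
  shows "finite_order A"
proof -
  have "transpose A = A"
    using \<open>axial A = 0\<close> by (simp add: axial_def vec_eq_iff forall_3 transpose_def)
  then have "A ** A = mat 1"
    using rotation_matrix_transpose_mult[OF A] by simp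
  then have "A [^]\<^bsub>SO3\<^esub> (2::nat) = \<one>\<^bsub>SO3\<^esub>"
    by (simp add: SO3_def numeral_2_eq_2)
  then show ?thesis
    unfolding finite_order_def by (intro exI[of _ 2]) simp
qed

text \<open>Let \<open>a = axial (P Q)\<close> and \<open>b = axial (Q P)\<close>. Conjugating \<open>P Q\<close> by \<open>Q\<close> and by the inverse of
  \<open>P\<close> gives \<open>b = Q a = P\<^sup>-\<^sup>1 a\<close>, so \<open>a\<close> and \<open>b\<close> have the same length. If \<open>P Q\<close> and \<open>Q P\<close> commute, then
  \<open>Q P\<close> fixes \<open>a\<close>, which is therefore parallel to \<open>b\<close>; hence \<open>b = s a\<close> with \<open>s = \<plusminus> 1\<close>. Infinite order
  ensures \<open>a \<noteq> 0\<close>, because a symmetric rotation is an involution.\<close>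

lemma commuting_products_common_eigenvector:
  assumes P: "rotation_matrix P" and Q: "rotation_matrix Q"
    and inf: "\<not> finite_order (P ** Q)"
    and comm: "(P ** Q) ** (Q ** P) = (Q ** P) ** (P ** Q)"
  obtains a s where "a \<noteq> 0" "s = 1 \<or> s = -1" "P *v a = s *\<^sub>R a" "Q *v a = s *\<^sub>R a"
proof -
  note PP = rotation_matrix_transpose_mult[OF P] and QQ = rotation_matrix_transpose_mult[OF Q]
  define a where "a = axial (P ** Q)"
  define b where "b = axial (Q ** P)"
  have PQ: "rotation_matrix (P ** Q)" and QP: "rotation_matrix (Q ** P)"
    using P Q by (simp_all add: rotation_matrix_mult)
  have a0: "a \<noteq> 0"
    using axial_zero_finite_order[OF PQ] inf unfolding a_def by blast
  have "Q ** (P ** Q) ** transpose Q = Q ** P"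
    by (simp add: QQ flip: matrix_mul_assoc)
  then have bQ: "Q *v a = b"
    unfolding a_def b_def by (metis axial_conjugate[OF Q])
  have "P ** (Q ** P) ** transpose P = P ** Q"
    by (simp add: PP flip: matrix_mul_assoc)
  then have bP: "P *v b = a"
    unfolding a_def b_def by (metis axial_conjugate[OF P])
  have "(Q ** P) ** (P ** Q) ** transpose (Q ** P) = P ** Q"
    unfolding comm[symmetric]
    by (simp add: rotation_matrix_transpose_mult[OF QP] flip: matrix_mul_assoc[of "P ** Q"])
  then have "(Q ** P) *v a = a"
    unfolding a_def by (metis axial_conjugate[OF QP])
  then have par: "cross3 b a = 0"
    unfolding b_def by (rule axial_cross_fixed[OF QP])
  have norm: "b \<bullet> b = a \<bullet> a"
    unfolding bQ[symmetric] by (rule rotation_matrix_inner[OF Q])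
  \<comment> \<open>\<open>b - a\<close> and \<open>b + a\<close> are parallel, and orthogonal since the lengths agree; so one of them vanishes.\<close>
  have "cross3 (b - a) (b + a) = 0"
    using par cross_skew[of a b]
    by (simp add: cross_add_right Cross3.left_diff_distrib)
  moreover have "(b - a) \<bullet> (b + a) = 0"
    using norm by (simp add: inner_diff_left inner_add_right inner_commute[of b a])
  ultimately have "b - a = 0 \<or> b + a = 0"
    using norm_and_cross_eq_0 by blast
  then consider "b = a" | "b = - a"
    by (auto simp: eq_neg_iff_add_eq_0)
  then show ?thesis
  proof cases
    case 1
    then show ?thesis
      using that[of a 1] a0 bP bQ by simp
  next
    case 2
    then have "P *v a = - a"
      using bP linear_neg[OF matrix_vector_mul_linear[of P], of a] by (simp add: minus_equation_iff)
    then show ?thesis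
      using that[of a "-1"] a0 bQ 2 by simp
  qed
qed


section \<open>Rotations about the first coordinate axis\<close>

lemma rot_first_axis_mult_vec:
  "rot_first_axis \<theta> *v x =
    vector [x$1, cos \<theta> * x$2 - sin \<theta> * x$3, sin \<theta> * x$2 + cos \<theta> * x$3]"
  by (simp add: rot_first_axis_def vec_eq_iff forall_3 matrix_vector_mult_def sum_3)

text \<open>The plane rotation by \<open>\<theta>\<close> minus \<open>s\<close> times the identity has determinant \<open>(cos \<theta> - s)\<^sup>2 + (sin \<theta>)\<^sup>2\<close>.\<close>

lemma rot_first_axis_eigenvector:
  assumes "rot_first_axis \<theta> *v x = s *\<^sub>R x" and "cos \<theta> \<noteq> s"
  shows "x$2 = 0" "x$3 = 0"
proof -
  have e: "cos \<theta> * x$2 - sin \<theta> * x$3 = s * x$2" "sin \<theta> * x$2 + cos \<theta> * x$3 = s * x$3"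
    using assms(1) by (simp_all add: rot_first_axis_mult_vec vec_eq_iff forall_3)
  have d: "(cos \<theta> - s)\<^sup>2 + (sin \<theta>)\<^sup>2 \<noteq> 0"
    using assms(2) by (auto simp: sum_power2_eq_zero_iff)
  have "((cos \<theta> - s)\<^sup>2 + (sin \<theta>)\<^sup>2) * x$2 = 0" "((cos \<theta> - s)\<^sup>2 + (sin \<theta>)\<^sup>2) * x$3 = 0"
    using e by algebra+
  then show "x$2 = 0" "x$3 = 0"
    using d by (metis mult_eq_0_iff)+
qed

lemma rot_first_axis_power:
  "rot_first_axis \<theta> [^]\<^bsub>SO3\<^esub> (n::nat) = rot_first_axis (real n * \<theta>)"
proof (induction n)
  case 0
  show ?case
    by (simp add: SO3_def rot_first_axis_def mat_def vec_eq_iff forall_3)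
next
  case (Suc n)
  have "real (Suc n) * \<theta> = real n * \<theta> + \<theta>"
    by (simp add: algebra_simps)
  then show ?case
    using Suc
    by (simp add: SO3_def rot_first_axis_def vec_eq_iff forall_3 matrix_matrix_mult_def sum_3
        cos_add sin_add algebra_simps)
qed

lemma finite_order_rot_first_axis:
  assumes "q \<in> \<rat>"
  shows "finite_order (rot_first_axis (q * pi))"
proof -
  obtain i :: int and n :: nat where n: "n \<noteq> 0" and q: "q = i / n"
    using assms unfolding Rats_eq_int_div_nat by blast
  have "real (2 * n) * (q * pi) = 2 * pi * of_int i"
    using n by (simp add: q)
  then have "rot_first_axis (q * pi) [^]\<^bsub>SO3\<^esub> (2 * n) = rot_first_axis (2 * pi * of_int i)"
    by (simp only: rot_first_axis_power)
  also have "\<dots> = \<one>\<^bsub>SO3\<^esub>"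
    by (simp add: SO3_def rot_first_axis_def mat_def vec_eq_iff forall_3)
  finally show ?thesis
    unfolding finite_order_def using n by (intro exI[of _ "2 * n"]) simp
qed

lemma finite_order_conjugate:
  assumes V: "rotation_matrix V" and "finite_order A"
  shows "finite_order (V ** A ** transpose V)"
proof -
  have VV: "transpose V ** (V ** B) = B" for B
    by (simp add: matrix_mul_assoc rotation_matrix_transpose_mult[OF V])
  have "(V ** A ** transpose V) [^]\<^bsub>SO3\<^esub> n = V ** (A [^]\<^bsub>SO3\<^esub> n) ** transpose V" for n :: nat
    by (induction n)
      (simp_all add: SO3_def VV rotation_matrix_transpose_mult[OF V] flip: matrix_mul_assoc)
  moreover obtain n :: nat where "n > 0" "A [^]\<^bsub>SO3\<^esub> n = \<one>\<^bsub>SO3\<^esub>"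
    using assms unfolding finite_order_def by blast
  ultimately show ?thesis
    unfolding finite_order_def
    by (intro exI[of _ n]) (simp add: SO3_def rotation_matrix_transpose_mult[OF V])
qed

text \<open>The first column of \<open>V\<close> spans the axis of the second factor, so \<open>V$1$1\<close> is the cosine of the
  angle between the two axes.\<close>

lemma trace_two_rotations:
  assumes V: "rotation_matrix V"
  shows "trace (rot_first_axis \<theta>\<^sub>1 ** (V ** rot_first_axis \<theta>\<^sub>2 ** transpose V)) =
    f_trace \<theta>\<^sub>1 \<theta>\<^sub>2 (arccos (V$1$1))"
proof -
  have "transpose V ** V = mat 1" "V ** transpose V = mat 1"
    using rotation_matrix_transpose_mult[OF V] by simp_all
  then have col: "(V$1$2)\<^sup>2 + (V$2$2)\<^sup>2 + (V$3$2)\<^sup>2 = 1" "(V$1$3)\<^sup>2 + (V$2$3)\<^sup>2 + (V$3$3)\<^sup>2 = 1"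
    and row: "(V$1$1)\<^sup>2 + (V$1$2)\<^sup>2 + (V$1$3)\<^sup>2 = 1" "(V$2$1)\<^sup>2 + (V$2$2)\<^sup>2 + (V$2$3)\<^sup>2 = 1"
      "(V$3$1)\<^sup>2 + (V$3$2)\<^sup>2 + (V$3$3)\<^sup>2 = 1"
      "(V$1$1)\<^sup>2 + (V$2$1)\<^sup>2 + (V$3$1)\<^sup>2 = 1"
    by (simp_all add: vec_eq_iff forall_3 matrix_matrix_mult_def sum_3 mat_def transpose_def
        power2_eq_square)
  have "(V$1$1)\<^sup>2 \<le> 1"
    using row(1) by (smt (verit) zero_le_power2)
  then have x: "cos (arccos (V$1$1)) = V$1$1"
    by (simp add: abs_square_le_1 abs_le_iff cos_arccos)
  define c\<^sub>1 s\<^sub>1 c\<^sub>2 s\<^sub>2 where "c\<^sub>1 = cos \<theta>\<^sub>1" "s\<^sub>1 = sin \<theta>\<^sub>1" "c\<^sub>2 = cos \<theta>\<^sub>2" "s\<^sub>2 = sin \<theta>\<^sub>2"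
  define M where "M = V ** rot_first_axis \<theta>\<^sub>2 ** transpose V"
  have M: "M$i$j = V$i$1 * V$j$1 + c\<^sub>2 * (V$i$2 * V$j$2 + V$i$3 * V$j$3)
      + s\<^sub>2 * (V$i$3 * V$j$2 - V$i$2 * V$j$3)" for i j
    by (simp add: M_def rot_first_axis_def matrix_matrix_mult_def sum_3 transpose_def c\<^sub>1_s\<^sub>1_c\<^sub>2_s\<^sub>2_def
        algebra_simps)
  have M11: "M$1$1 = (V$1$1)\<^sup>2 + c\<^sub>2 * (1 - (V$1$1)\<^sup>2)"
    unfolding M using row by algebra
  have M23: "M$2$2 + M$3$3 = (1 - (V$1$1)\<^sup>2) + c\<^sub>2 * (1 + (V$1$1)\<^sup>2)"
    unfolding M using row col by algebra
  have skew: "M$2$3 - M$3$2 = - 2 * s\<^sub>2 * V$1$1"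
    unfolding M rotation_matrix_eq_cofactors(1)[OF V] by algebra
  have "trace (rot_first_axis \<theta>\<^sub>1 ** M) = M$1$1 + c\<^sub>1 * (M$2$2 + M$3$3) + s\<^sub>1 * (M$2$3 - M$3$2)"
    by (simp add: trace_def rot_first_axis_def matrix_matrix_mult_def sum_3 c\<^sub>1_s\<^sub>1_c\<^sub>2_s\<^sub>2_def
        algebra_simps)
  also have "\<dots> = f_trace \<theta>\<^sub>1 \<theta>\<^sub>2 (arccos (V$1$1))"
    unfolding M11 M23 skew f_trace_def sin_squared_eq x c\<^sub>1_s\<^sub>1_c\<^sub>2_s\<^sub>2_def by algebra
  finally show ?thesis
    unfolding M_def .
qed

lemma vec_angle_first_axis:
  fixes V :: "real^3^3"
  assumes "rotation_matrix V"
  shows "vec_angle (vector [1, 0, 0]) (column 1 V) = arccos (V$1$1)"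
proof -
  have "norm (column 1 V) = 1"
    using assms by (simp add: rotation_matrix_def orthogonal_matrix_orthonormal_columns)
  moreover have "norm (vector [1, 0, 0] :: real^3) = 1"
    by (simp add: norm_eq_1 inner_vec_def sum_3)
  moreover have "vector [1, 0, 0] \<bullet> column 1 V = V$1$1"
    by (simp add: inner_vec_def sum_3 column_def)
  ultimately show ?thesis
    by (simp add: vec_angle_def)
qed

text \<open>If \<open>s = 1\<close>, then \<open>a\<close> spans both axes, so the first column of \<open>V\<close> is plus or minus the first
  unit vector. A nontrivial rotation has the eigenvalue \<open>-1\<close> only if it is a half-turn, which settles
  \<open>s = -1\<close>.\<close>

lemma common_eigenvector_cases:
  assumes V: "rotation_matrix V" and a: "a \<noteq> 0" and s: "s = 1 \<or> s = -1"
    and \<theta>: "\<theta>\<^sub>1 \<in> {0<..<2 * pi}" "\<theta>\<^sub>2 \<in> {0<..<2 * pi}"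
    and 1: "rot_first_axis \<theta>\<^sub>1 *v a = s *\<^sub>R a"
    and 2: "(V ** rot_first_axis \<theta>\<^sub>2 ** transpose V) *v a = s *\<^sub>R a"
  shows "\<bar>V$1$1\<bar> = 1 \<or> \<theta>\<^sub>1 = pi \<and> \<theta>\<^sub>2 = pi"
proof -
  have cos1: "cos \<theta> \<noteq> 1" if "\<theta> \<in> {0<..<2 * pi}" for \<theta>
  proof
    assume "cos \<theta> = 1"
    then obtain k :: int where "\<theta> = of_int k * 2 * pi"
      unfolding cos_one_2pi_int by auto
    with that have "0 < of_int k * (2 * pi)" "of_int k * (2 * pi) < 1 * (2 * pi)"
      by simp_all
    then have "0 < k" "k < 1"
      by (simp_all add: zero_less_mult_iff)
    then show False
      by linarith
  qed
  have cosm1: "\<theta> = pi" if "\<theta> \<in> {0<..<2 * pi}" "cos \<theta> = -1" for \<theta>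
  proof -
    have "cos (\<theta> - pi) = 1"
      using that by (simp add: cos_diff)
    then obtain k :: int where k: "\<theta> - pi = of_int k * 2 * pi"
      unfolding cos_one_2pi_int by auto
    with that have "0 < pi * of_int (2 * k + 1)" "0 < pi * of_int (1 - 2 * k)"
      by (simp_all add: algebra_simps)
    then have "0 < 2 * k + 1" "0 < 1 - 2 * k"
      using pi_gt_zero by (simp_all only: zero_less_mult_iff of_int_0_less_iff) auto
    then have "k = 0"
      by linarith
    then show ?thesis
      using k by simp
  qed
  define y where "y = transpose V *v a"
  have a_y: "V *v y = a"
    using rotation_matrix_transpose_eq_iff[OF V] y_def by blast
  have y0: "y \<noteq> 0"
    using a a_y by auto
  have y: "rot_first_axis \<theta>\<^sub>2 *v y = s *\<^sub>R y"
  proof -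
    have "V *v (rot_first_axis \<theta>\<^sub>2 *v y) = s *\<^sub>R a"
      using 2 by (simp add: y_def matrix_vector_mul_assoc matrix_mul_assoc del: transpose_matrix_vector)
    then have "transpose V *v (s *\<^sub>R a) = rot_first_axis \<theta>\<^sub>2 *v y"
      using rotation_matrix_transpose_eq_iff[OF V] by blast
    then show ?thesis
      by (simp add: y_def matrix_vector_mult_scaleR del: transpose_matrix_vector)
  qed
  have half_turn: "\<theta> = pi" if "\<theta> \<in> {0<..<2 * pi}" "s = -1" "x \<noteq> 0"
      "rot_first_axis \<theta> *v x = s *\<^sub>R x" for \<theta> and x :: "real^3"
  proof (rule ccontr)
    assume "\<theta> \<noteq> pi"
    then have "x$2 = 0" "x$3 = 0"
      using that cosm1 rot_first_axis_eigenvector[of \<theta> x s] by auto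
    moreover have "x$1 = 0"
      using that by (simp add: rot_first_axis_mult_vec vec_eq_iff forall_3)
    ultimately show False
      using \<open>x \<noteq> 0\<close> by (simp add: vec_eq_iff forall_3)
  qed
  show ?thesis
  proof (cases "s = 1")
    case True
    have "a$2 = 0" "a$3 = 0"
      using rot_first_axis_eigenvector[OF 1] True cos1[OF \<theta>(1)] by simp_all
    have "y$2 = 0" "y$3 = 0"
      using rot_first_axis_eigenvector[OF y] True cos1[OF \<theta>(2)] by simp_all
    have "a \<bullet> a = y \<bullet> y"
      unfolding a_y[symmetric] by (rule rotation_matrix_inner[OF V])
    have "a$1 = V$1$1 * y$1"
      using \<open>y$2 = 0\<close> \<open>y$3 = 0\<close> by (simp add: a_y[symmetric] matrix_vector_mult_def sum_3)
    moreover have "\<bar>a$1\<bar> = \<bar>y$1\<bar>"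
      using \<open>a \<bullet> a = y \<bullet> y\<close> \<open>a$2 = 0\<close> \<open>a$3 = 0\<close> \<open>y$2 = 0\<close> \<open>y$3 = 0\<close>
      by (simp add: inner_vec_def sum_3 abs_eq_iff square_eq_iff)
    moreover have "y$1 \<noteq> 0"
      using y0 \<open>y$2 = 0\<close> \<open>y$3 = 0\<close> by (simp add: vec_eq_iff forall_3)
    ultimately show ?thesis
      by (simp add: abs_mult)
  next
    case False
    then show ?thesis
      using s half_turn \<theta> 1 y a y0 by blast
  qed
qed


section \<open>The topological holonomy group\<close>

theorem theorem7p1:
  fixes E :: "(4, 'v::real_vector) vbundle"
    and h :: "torus \<Rightarrow> 'v \<Rightarrow> 'v \<Rightarrow> real"
    and D :: "'v connection_op"
    and D' :: "'v bivector connection_op"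
    and \<epsilon> :: real
    and \<omega> :: "3 \<Rightarrow> 'v bivector"
    and C\<^sub>1 C\<^sub>2 V :: "real^3^3"
    and \<theta>\<^sub>1 \<theta>\<^sub>2 \<phi> q\<^sub>1 q\<^sub>2 :: real
  assumes "oriented_rank4_bundle E"
    and "bundle_metric E h"
    and "metric_connection E h D"
    and "induced_connection E D D'"
    and "\<epsilon> = 1 \<or> \<epsilon> = -1"
    and "Lambda_positive_orthonormal_basis E h \<epsilon> (pr (0, 0)) \<omega>"
    and "holonomy_matrix E h D' \<epsilon> \<omega> (1, 0) C\<^sub>1"
    and "holonomy_matrix E h D' \<epsilon> \<omega> (0, 1) C\<^sub>2"
    and "C\<^sub>1 \<noteq> mat 1" and "C\<^sub>2 \<noteq> mat 1"
    and "\<theta>\<^sub>1 \<in> {0<..<2 * pi}" and "C\<^sub>1 = rot_first_axis \<theta>\<^sub>1"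
    and "\<theta>\<^sub>2 \<in> {0<..<2 * pi}" and "rotation_matrix V"
    and "C\<^sub>2 = V ** rot_first_axis \<theta>\<^sub>2 ** transpose V"
    and "\<phi> = vec_angle (vector [1, 0, 0]) (column 1 V)" and "\<phi> \<in> {0<..pi / 2}"
    and "\<theta>\<^sub>1 = q\<^sub>1 * pi" and "\<theta>\<^sub>2 = q\<^sub>2 * pi"
    and "(q\<^sub>1, q\<^sub>2) \<in> \<rat> \<times> \<rat> - \<int> \<times> \<int>"
    and "f_trace \<theta>\<^sub>1 \<theta>\<^sub>2 \<phi> \<in> I_range \<theta>\<^sub>1 \<theta>\<^sub>2 - S_set"
  shows "topological_holonomy_group E h D' \<epsilon> \<omega> = generate SO3 {C\<^sub>1, C\<^sub>2} \<and>
    finite_order C\<^sub>1 \<and> finite_order C\<^sub>2 \<and>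
    C\<^sub>1 ** C\<^sub>2 \<in> topological_holonomy_group E h D' \<epsilon> \<omega> \<and>
    C\<^sub>2 ** C\<^sub>1 \<in> topological_holonomy_group E h D' \<epsilon> \<omega> \<and>
    \<not> finite_order (C\<^sub>1 ** C\<^sub>2) \<and> \<not> finite_order (C\<^sub>2 ** C\<^sub>1) \<and>
    (C\<^sub>1 ** C\<^sub>2) ** (C\<^sub>2 ** C\<^sub>1) \<noteq> (C\<^sub>2 ** C\<^sub>1) ** (C\<^sub>1 ** C\<^sub>2)"
proof -
  note C1 = assms(12) and C2 = assms(15) and V = assms(14)
  let ?G = "topological_holonomy_group E h D' \<epsilon> \<omega>"
  have "{C. holonomy_matrix E h D' \<epsilon> \<omega> (1, 0) C \<or> holonomy_matrix E h D' \<epsilon> \<omega> (0, 1) C} = {C\<^sub>1, C\<^sub>2}"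
    using holonomy_matrix_unique[OF assms(1,6)] assms(7,8) by blast
  then have G: "?G = generate SO3 {C\<^sub>1, C\<^sub>2}"
    unfolding topological_holonomy_group_def by simp
  have mem: "A ** B \<in> ?G" if "A \<in> {C\<^sub>1, C\<^sub>2}" "B \<in> {C\<^sub>1, C\<^sub>2}" for A B
    using generate.eng[OF generate.incl generate.incl, of A "{C\<^sub>1, C\<^sub>2}" B SO3] that
    unfolding G by (simp add: SO3_def)
  have q: "q\<^sub>1 \<in> \<rat>" "q\<^sub>2 \<in> \<rat>" "\<not> (q\<^sub>1 \<in> \<int> \<and> q\<^sub>2 \<in> \<int>)"
    using assms(20) by auto
  have fin: "finite_order C\<^sub>1" "finite_order C\<^sub>2"
    unfolding C1 C2 assms(18,19) using q V
    by (simp_all add: finite_order_rot_first_axis finite_order_conjugate)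
  have rot: "rotation_matrix C\<^sub>1" "rotation_matrix C\<^sub>2"
    using assms(7,8) unfolding holonomy_matrix_def by blast+
  have \<phi>: "\<phi> = arccos (V$1$1)"
    using assms(16) vec_angle_first_axis[OF V] by simp
  have tr: "trace (C\<^sub>1 ** C\<^sub>2) \<notin> S_set"
    using assms(21) trace_two_rotations[OF V] unfolding C1 C2 \<phi> by simp
  have inf: "\<not> finite_order (C\<^sub>1 ** C\<^sub>2)" "\<not> finite_order (C\<^sub>2 ** C\<^sub>1)"
    using finite_order_trace_in_S_set rotation_matrix_mult rot tr trace_mul_sym[of C\<^sub>1 C\<^sub>2] by metis+
  have "(C\<^sub>1 ** C\<^sub>2) ** (C\<^sub>2 ** C\<^sub>1) \<noteq> (C\<^sub>2 ** C\<^sub>1) ** (C\<^sub>1 ** C\<^sub>2)"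
  proof
    assume "(C\<^sub>1 ** C\<^sub>2) ** (C\<^sub>2 ** C\<^sub>1) = (C\<^sub>2 ** C\<^sub>1) ** (C\<^sub>1 ** C\<^sub>2)"
    then obtain a s where "a \<noteq> 0" "s = 1 \<or> s = -1" "C\<^sub>1 *v a = s *\<^sub>R a" "C\<^sub>2 *v a = s *\<^sub>R a"
      using commuting_products_common_eigenvector[OF rot inf(1)] by blast
    then have "\<bar>V$1$1\<bar> = 1 \<or> \<theta>\<^sub>1 = pi \<and> \<theta>\<^sub>2 = pi"
      using common_eigenvector_cases[OF V _ _ assms(11,13)] unfolding C1 C2 by blast
    then show False
    proof
      assume "\<bar>V$1$1\<bar> = 1"
      then have "V$1$1 = 1 \<or> V$1$1 = - 1"
        by linarith
      then have "\<phi> = 0 \<or> \<phi> = pi"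
        unfolding \<phi> by auto
      then show False
        using assms(17) pi_gt_zero by auto
    next
      assume "\<theta>\<^sub>1 = pi \<and> \<theta>\<^sub>2 = pi"
      then have "q\<^sub>1 = 1" "q\<^sub>2 = 1"
        using assms(18,19) by simp_all
      then show False
        using q(3) by simp
    qed
  qed
  then show ?thesis
    using G fin inf mem by blast
qed

end
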